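(* Let $\mathcal{M}_{\mathrm{sim}}$ and $\mathcal{M}_{\mathrm{real}}$ be Markov decision processes sharing the same state space, action space, reward function, discount factor and initial state distribution and differing only in their transition dynamics, and let $\pi_{\mathrm{base}}$ be a realizable policy. Assume: (A) (Simulation is a reliable evaluator of realizable policies.) For any two realizable policies $\pi$ and $\pi'$, $J_{\mathrm{sim}}(\pi)\ge J_{\mathrm{sim}}(\pi')$ implies $J_{\mathrm{real}}(\pi)\ge J_{\mathrm{real}}(\pi')$. (B) (Realizability is closed under support.) If $\pi$ is realizable and $\pi'(\cdot\mid s)\ll\pi(\cdot\mid s)$ for all states $s$, then $\pi'$ is realizable. Write $\pi\ll\pi_{\mathrm{base}}$ if $\pi(\cdot\mid s)\ll\pi_{\mathrm{base}}(\cdot\mid s)$ for all states $s$. Let $\pi^*_{\mathrm{base}}\in\arg\max_{\pi\ll\pi_{\mathrm{base}}}J_{\mathrm{real}}(\pi)$ and let $\pi_{\mathrm{supp}}\in\arg\max_{\pi\ll\pi_{\mathrm{base}}}J_{\mathrm{sim}}(\pi)$. Then $\pi_{\mathrm{supp}}$ is realizable and $J_{\mathrm{real}}(\pi_{\mathrm{supp}})\ge J_{\mathrm{real}}(\pi^*_{\mathrm{base}})$.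
   Context: Setting. $\mathcal{M}_{\mathrm{sim}}$ and $\mathcal{M}_{\mathrm{real}}$ are Markov decision processes with common state space $\mathcal{S}$, action space $\mathcal{A}$, reward function $r:\mathcal{S}\times\mathcal{A}\to\mathbb{R}$, discount factor $\gamma\in(0,1)$, horizon $T$ and initial state distribution $p_1$. They differ only in their transition dynamics $p_{\mathrm{sim}}(s_{t+1}\mid s_t,a_t)$ and $p_{\mathrm{real}}(s_{t+1}\mid s_t,a_t)$. A policy $\pi$ assigns to each state $s$ a probability distribution $\pi(\cdot\mid s)$ on $\mathcal{A}$. Its returns are $$J_{\mathrm{sim}}(\pi)=\mathbb{E}_{\pi,p_{\mathrm{sim}}}\Big[\sum_{t=1}^{T}\gamma^{t-1}r(s_t,a_t)\Big],\qquad J_{\mathrm{real}}(\pi)=\mathbb{E}_{\pi,p_{\mathrm{real}}}\Big[\sum_{t=1}^{T}\gamma^{t-1}r(s_t,a_t)\Big],$$ where trajectories start from $s_1\sim p_1$ and follow the indicated dynamics. Realizability. Let $\rho^{\pi}$ denote the state-action visitation measure of $\pi$ in $\mathcal{M}_{\mathrm{real}}$. A state-action pair $(s,a)$ is realizable if $\rho^{\pi}(s,a)>0$ for some policy $\pi$, and unrealizable otherwise. By convention, $r(s,a)=0$ whenever $(s,a)$ is unrealizable, and unrealizable pairs result in episode termination in the real world. A policy is realizable if every pair $(s,a)$ in the support of its state-action visitation measure in $\mathcal{M}_{\mathrm{sim}}$ is a realizable pair; otherwise it is unrealizable. $\mu\ll\nu$ denotes absolute continuity of the measure $\mu$ with respect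 to $\nu$. *)

theory Defs
  imports "HOL-Probability.Probability"
begin

text \<open>
  State and action spaces are arbitrary second countable topological spaces with their Borel
  sigma-algebras (second countability makes the Borel sets of the product type the product
  sigma-algebra). Countable spaces are the case of a discrete topology.

  \<open>terminal\<close> is the set of state-action pairs that end the episode: such a pair is still visited
  and still earns its reward, but nothing after it counts.
\<close>

record ('s, 'a) mdp =
  init :: "'s measure"
  trans :: "'s \<times> 'a \<Rightarrow> 's measure"
  terminal :: "('s \<times> 'a) set"
  reward :: "'s \<times> 'a \<Rightarrow> real"
  discount :: real
  horizon :: nat

definition is_mdp ::
  "('s::second_countable_topology, 'a::second_countable_topology) mdp \<Rightarrow> bool" where
  "is_mdp M \<longleftrightarrow>
     init M \<in> space (prob_algebra borel) \<and>
     trans M \<in> borel \<rightarrow>\<^sub>M prob_algebra borel \<and>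
     terminal M \<in> sets borel \<and>
     reward M \<in> borel_measurable borel \<and>
     0 < discount M \<and> discount M < 1"

definition is_policy :: "('s::topological_space \<Rightarrow> 'a::topological_space measure) \<Rightarrow> bool" where
  "is_policy \<pi> \<longleftrightarrow> \<pi> \<in> borel \<rightarrow>\<^sub>M prob_algebra borel"

text \<open>The law of \<open>(s, a)\<close> for \<open>s\<close> drawn from \<open>\<mu>\<close> and \<open>a\<close> drawn from \<open>\<pi> s\<close>.\<close>

definition act ::
  "('s::topological_space \<Rightarrow> 'a::topological_space measure) \<Rightarrow> 's measure \<Rightarrow> ('s \<times> 'a) measure" where
  "act \<pi> \<mu> = \<mu> \<bind> (\<lambda>s. \<pi> s \<bind> (\<lambda>a. return borel (s, a)))"

text \<open>Conditional law of the pair at time \<open>n\<close> given the pairs at times \<open>0, \<dots>, n - 1\<close>.\<close>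

definition step_kernel ::
  "('s::topological_space, 'a::topological_space) mdp \<Rightarrow> ('s \<Rightarrow> 'a measure) \<Rightarrow>
     nat \<Rightarrow> (nat \<Rightarrow> 's \<times> 'a) \<Rightarrow> ('s \<times> 'a) measure" where
  "step_kernel M \<pi> n \<omega> = act \<pi> (if n = 0 then init M else trans M (\<omega> (n - 1)))"

text \<open>
  Law of the trajectory \<open>\<omega> 0, \<dots>, \<omega> (horizon M - 1)\<close>. Time is counted from 0, so \<open>\<omega> t\<close> is the pair
  usually written with index \<open>t + 1\<close>. The process is run up to the horizon irrespective of
  termination, which is taken into account by \<open>running\<close> below.
\<close>

definition trajectory ::
  "('s::topological_space, 'a::topological_space) mdp \<Rightarrow> ('s \<Rightarrow> 'a measure) \<Rightarrow>
     (nat \<Rightarrow> 's \<times> 'a) measure" where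
  "trajectory M \<pi> =
     Ionescu_Tulcea.C (step_kernel M \<pi>) (\<lambda>_. borel) 0 (horizon M) (\<lambda>_. undefined)"

definition running :: "('s, 'a) mdp \<Rightarrow> (nat \<Rightarrow> 's \<times> 'a) \<Rightarrow> nat \<Rightarrow> bool" where
  "running M \<omega> t \<longleftrightarrow> (\<forall>u<t. \<omega> u \<notin> terminal M)"

definition expected_return ::
  "('s::topological_space, 'a::topological_space) mdp \<Rightarrow> ('s \<Rightarrow> 'a measure) \<Rightarrow> real" where
  "expected_return M \<pi> =
     (\<integral>\<omega>. (\<Sum>t<horizon M. if running M \<omega> t then discount M ^ t * reward M (\<omega> t) else 0)
        \<partial>trajectory M \<pi>)"

definition visitation ::
  "('s::topological_space, 'a::topological_space) mdp \<Rightarrow> ('s \<Rightarrow> 'a measure) \<Rightarrow>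
     ('s \<times> 'a) measure" where
  "visitation M \<pi> = measure_of UNIV (sets borel)
     (\<lambda>B. \<Sum>t<horizon M. ennreal (discount M ^ t) *
        emeasure (trajectory M \<pi>) {\<omega> \<in> space (trajectory M \<pi>). running M \<omega> t \<and> \<omega> t \<in> B})"

definition support :: "'x::topological_space measure \<Rightarrow> 'x set" where
  "support \<mu> = {x. \<forall>U. open U \<longrightarrow> x \<in> U \<longrightarrow> emeasure \<mu> U > 0}"

text \<open>
  Positivity of a visitation measure at a pair is read as membership in its support, so that it
  is meaningful in continuous spaces. For discrete spaces this is positivity of the mass of the
  pair, see \<open>realizable_pair_discrete\<close> below.
\<close>

definition realizable_pair ::
  "('s::topological_space, 'a::topological_space) mdp \<Rightarrow> 's \<times> 'a \<Rightarrow> bool" where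
  "realizable_pair M_real x \<longleftrightarrow> (\<exists>\<pi>. is_policy \<pi> \<and> x \<in> support (visitation M_real \<pi>))"

definition realizable_policy ::
  "('s::topological_space, 'a::topological_space) mdp \<Rightarrow> ('s, 'a) mdp \<Rightarrow>
     ('s \<Rightarrow> 'a measure) \<Rightarrow> bool" where
  "realizable_policy M_sim M_real \<pi> \<longleftrightarrow>
     is_policy \<pi> \<and> (\<forall>x \<in> support (visitation M_sim \<pi>). realizable_pair M_real x)"

text \<open>Note that \<open>absolutely_continuous \<nu> \<mu>\<close> stands for \<open>\<mu> \<lless> \<nu>\<close>.\<close>

definition policy_ac :: "('s \<Rightarrow> 'a measure) \<Rightarrow> ('s \<Rightarrow> 'a measure) \<Rightarrow> bool" (infix "\<lless>" 50) where
  "\<pi>' \<lless> \<pi> \<longleftrightarrow> (\<forall>s. absolutely_continuous (\<pi> s) (\<pi>' s))"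


lemma support_discrete:
  fixes \<mu> :: "'x::topological_space measure"
  assumes "sets \<mu> = sets borel" "open {x}"
  shows "x \<in> support \<mu> \<longleftrightarrow> emeasure \<mu> {x} > 0"
proof
  assume "emeasure \<mu> {x} > 0"
  moreover have "emeasure \<mu> {x} \<le> emeasure \<mu> U" if "open U" "x \<in> U" for U
    using that assms(1) by (intro emeasure_mono) auto
  ultimately show "x \<in> support \<mu>"
    unfolding support_def by (auto intro: less_le_trans)
qed (use assms(2) in \<open>auto simp: support_def\<close>)

lemma sets_visitation [simp]: "sets (visitation M \<pi>) = sets borel"
  unfolding visitation_def using sets.sigma_sets_eq[of borel] by (simp add: sets_measure_of_conv)

lemma realizable_pair_discrete:
  fixes M :: "('s::discrete_topology, 'a::discrete_topology) mdp"
  shows "realizable_pair M x \<longleftrightarrow> (\<exists>\<pi>. is_policy \<pi> \<and> emeasure (visitation M \<pi>) {x} > 0)"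
proof -
  have "{x} = {fst x} \<times> {snd x}" by auto
  moreover have "open ({fst x} \<times> {snd x})"
    by (intro open_Times discrete_topology_class.open_discrete)
  ultimately have "open {x}" by (simp only:)
  then show ?thesis
    by (simp add: realizable_pair_def support_discrete)
qed

lemma measurable_act:
  assumes "is_policy (\<pi> :: 's::second_countable_topology \<Rightarrow> 'a::second_countable_topology measure)"
  shows "act \<pi> \<in> prob_algebra borel \<rightarrow>\<^sub>M prob_algebra borel"
proof -
  have \<pi>: "\<pi> \<in> borel \<rightarrow>\<^sub>M prob_algebra borel"
    using assms by (simp add: is_policy_def)
  have P: "(\<lambda>p. return borel p) \<in> borel \<Otimes>\<^sub>M borel \<rightarrow>\<^sub>M prob_algebra (borel :: ('s \<times> 'a) measure)"
    unfolding borel_prod by (rule measurable_return_prob_space)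
  have "(\<lambda>(s, a). return borel (s, a)) \<in> borel \<Otimes>\<^sub>M borel \<rightarrow>\<^sub>M prob_algebra (borel :: ('s \<times> 'a) measure)"
    using P by (simp add: case_prod_unfold)
  then have 1: "(\<lambda>s. \<pi> s \<bind> (\<lambda>a. return borel (s, a))) \<in> borel \<rightarrow>\<^sub>M prob_algebra borel"
    by (rule measurable_bind_prob_space2[OF \<pi>])
  show ?thesis
    unfolding act_def by (rule measurable_bind_prob_space[OF measurable_ident 1, unfolded id_def])
qed

lemma Ionescu_Tulcea_step_kernel:
  assumes M: "is_mdp M" and \<pi>: "is_policy \<pi>"
  shows "Ionescu_Tulcea (step_kernel M \<pi>) (\<lambda>_. borel)"
proof -
  have tr [measurable]: "trans M \<in> borel \<rightarrow>\<^sub>M prob_algebra borel"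
    and [measurable]: "act \<pi> \<in> prob_algebra borel \<rightarrow>\<^sub>M prob_algebra borel"
    and i: "init M \<in> space (prob_algebra borel)"
    using M measurable_act[OF \<pi>] by (auto simp: is_mdp_def)
  have K: "step_kernel M \<pi> n \<in> PiM {0..<n} (\<lambda>_. borel) \<rightarrow>\<^sub>M prob_algebra borel" for n
  proof (cases n)
    case 0
    then show ?thesis
      using measurable_space[OF measurable_act[OF \<pi>] i] by (simp add: step_kernel_def[abs_def])
  next
    case (Suc m)
    have [measurable]: "(\<lambda>\<omega>. \<omega> m) \<in> PiM {0..<n} (\<lambda>_. borel) \<rightarrow>\<^sub>M borel"
      using Suc by (intro measurable_component_singleton) auto
    have "(\<lambda>\<omega>. act \<pi> (trans M (\<omega> m))) \<in> PiM {0..<n} (\<lambda>_. borel) \<rightarrow>\<^sub>M prob_algebra borel"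
      by measurable
    then show ?thesis
      by (simp add: step_kernel_def[abs_def] Suc)
  qed
  show ?thesis
  proof (rule Ionescu_Tulcea.intro)
    show "step_kernel M \<pi> n \<in> PiM {0..<n} (\<lambda>_. borel) \<rightarrow>\<^sub>M subprob_algebra borel" for n
      by (rule measurable_prob_algebraD[OF K])
    show "prob_space (step_kernel M \<pi> n \<omega>)" if "\<omega> \<in> space (PiM {0..<n} (\<lambda>_. borel))" for n \<omega>
      using measurable_space[OF K that] by (simp add: space_prob_algebra)
  qed
qed

lemma emeasure_visitation:
  assumes M: "is_mdp M" and \<pi>: "is_policy \<pi>" and B: "B \<in> sets borel"
  shows "emeasure (visitation M \<pi>) B = (\<Sum>t<horizon M. ennreal (discount M ^ t) *
    emeasure (trajectory M \<pi>) {\<omega> \<in> space (trajectory M \<pi>). running M \<omega> t \<and> \<omega> t \<in> B})"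
proof -
  interpret Ionescu_Tulcea "step_kernel M \<pi>" "\<lambda>_. borel"
    using M \<pi> by (rule Ionescu_Tulcea_step_kernel)
  let ?P = "trajectory M \<pi>"
  let ?E = "\<lambda>t B. {\<omega> \<in> space ?P. running M \<omega> t \<and> \<omega> t \<in> B}"
  have sP: "sets ?P = sets (PiM {0..<horizon M} (\<lambda>_. borel))"
    using sets_C[of "\<lambda>_. undefined" 0 "horizon M"] by (simp add: trajectory_def space_PiM)
  have comp: "(\<lambda>\<omega>. \<omega> t) \<in> ?P \<rightarrow>\<^sub>M borel" if "t < horizon M" for t
    using that by (subst measurable_cong_sets[OF sP refl]) (auto intro: measurable_component_singleton)
  have E: "?E t B \<in> sets ?P" if t: "t < horizon M" and B: "B \<in> sets borel" for t B
  proof -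
    have pre: "{\<omega> \<in> space ?P. \<omega> u \<in> X} \<in> sets ?P" if "u < horizon M" "X \<in> sets borel" for u X
      using measurable_sets[OF comp[OF that(1)] that(2)] by (simp add: vimage_def Int_def conj_commute)
    have "{\<omega> \<in> space ?P. \<forall>u\<in>{..<t}. \<omega> u \<notin> terminal M} \<in> sets ?P"
    proof (cases "t = 0")
      case False
      with t M show ?thesis
        by (intro sets.sets_Collect_finite_All' sets.sets_Collect_neg pre)
          (auto simp: is_mdp_def lessThan_empty_iff)
    qed simp
    moreover have "?E t B =
        {\<omega> \<in> space ?P. \<forall>u\<in>{..<t}. \<omega> u \<notin> terminal M} \<inter> {\<omega> \<in> space ?P. \<omega> t \<in> B}"
      by (auto simp: running_def)
    ultimately show ?thesis
      using pre[OF t B] by (simp only: sets.Int)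
  qed
  show ?thesis
  proof (rule emeasure_measure_of[OF visitation_def])
    show "countably_additive (sets (visitation M \<pi>)) (\<lambda>B. \<Sum>t<horizon M. ennreal (discount M ^ t) * emeasure ?P (?E t B))"
    proof (rule countably_additiveI)
      fix A :: "nat \<Rightarrow> _" assume A: "range A \<subseteq> sets (visitation M \<pi>)" "disjoint_family A"
      have *: "emeasure ?P (?E t (\<Union>i. A i)) = (\<Sum>i. emeasure ?P (?E t (A i)))" if "t < horizon M" for t
      proof -
        have "?E t (\<Union>i. A i) = (\<Union>i. ?E t (A i))" by auto
        moreover have "disjoint_family (\<lambda>i. ?E t (A i))"
          using A(2) unfolding disjoint_family_on_def by fast
        ultimately show ?thesis
          using A(1) that by (subst suminf_emeasure) (auto intro!: E)
      qed
      have "(\<Sum>i. \<Sum>t<horizon M. ennreal (discount M ^ t) * emeasure ?P (?E t (A i)))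
        = (\<Sum>t<horizon M. \<Sum>i. ennreal (discount M ^ t) * emeasure ?P (?E t (A i)))"
        by (intro suminf_sum) auto
      also have "\<dots> = (\<Sum>t<horizon M. ennreal (discount M ^ t) * emeasure ?P (?E t (\<Union>i. A i)))"
        by (intro sum.cong refl) (simp only: ennreal_suminf_cmult lessThan_iff *)
      finally show "(\<Sum>i. \<Sum>t<horizon M. ennreal (discount M ^ t) * emeasure ?P (?E t (A i)))
        = (\<Sum>t<horizon M. ennreal (discount M ^ t) * emeasure ?P (?E t (\<Union>i. A i)))" .
    qed
  qed (use B in \<open>auto simp: positive_def\<close>)
qed

end

theory Submission
  imports Defs
begin

text \<open>Both maximizers are taken over the same class, the policies dominated by
  \<open>\<pi>_base\<close>. Closure under support (\<open>B\<close>), applied to the realizable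
  \<open>\<pi>_base\<close>, puts this whole class among the realizable policies, and there
  \<open>A\<close> carries every comparison of simulated returns over to real returns. Since
  \<open>\<pi>_star\<close> is itself a competitor in the problem that \<open>\<pi>_supp\<close>
  solves, the simulated comparison comes for free.\<close>

theorem propositionE3:
  fixes M_sim M_real :: "('s::second_countable_topology, 'a::second_countable_topology) mdp"
    and \<pi>_base \<pi>_star \<pi>_supp :: "'s \<Rightarrow> 'a measure"
  assumes "is_mdp M_sim" and "is_mdp M_real"
    and "init M_sim = init M_real" and "reward M_sim = reward M_real"
    and "discount M_sim = discount M_real" and "horizon M_sim = horizon M_real"
    and unrealizable: "\<And>x. \<not> realizable_pair M_real x \<Longrightarrow> reward M_real x = 0 \<and> x \<in> terminal M_real"
    and base: "realizable_policy M_sim M_real \<pi>_base"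
    and A: "\<And>\<pi> \<pi>'. realizable_policy M_sim M_real \<pi> \<Longrightarrow> realizable_policy M_sim M_real \<pi>' \<Longrightarrow>
      expected_return M_sim \<pi> \<ge> expected_return M_sim \<pi>' \<Longrightarrow>
      expected_return M_real \<pi> \<ge> expected_return M_real \<pi>'"
    and B: "\<And>\<pi> \<pi>'. realizable_policy M_sim M_real \<pi> \<Longrightarrow> is_policy \<pi>' \<Longrightarrow> \<pi>' \<lless> \<pi> \<Longrightarrow>
      realizable_policy M_sim M_real \<pi>'"
    and star: "is_arg_max (expected_return M_real) (\<lambda>\<pi>. is_policy \<pi> \<and> \<pi> \<lless> \<pi>_base) \<pi>_star"
    and supp: "is_arg_max (expected_return M_sim) (\<lambda>\<pi>. is_policy \<pi> \<and> \<pi> \<lless> \<pi>_base) \<pi>_supp"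
  shows "realizable_policy M_sim M_real \<pi>_supp \<and>
    expected_return M_real \<pi>_supp \<ge> expected_return M_real \<pi>_star"
proof -
  have star_real: "realizable_policy M_sim M_real \<pi>_star"
    using star B[OF base] by (simp add: is_arg_max_def)
  have supp_real: "realizable_policy M_sim M_real \<pi>_supp"
    using supp B[OF base] by (simp add: is_arg_max_def)
  \<comment> \<open>\<open>is_arg_max\<close> only says that no feasible policy is strictly better;
    as returns are real and hence linearly ordered, \<open>is_arg_max_linorder\<close> turns this
    into an inequality against each feasible policy, here \<open>\<pi>_star\<close>.\<close>
  have "expected_return M_sim \<pi>_supp \<ge> expected_return M_sim \<pi>_star"
    using star supp by (auto simp: is_arg_max_linorder)
  then show ?thesis
    using A[OF supp_real star_real] supp_real by simp
qed

end
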